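(* Let $\mathbb K$ be a field of characteristic different from $2$, let $(\mathfrak g,\cdot,\ast)$ be a compatible pre-Lie algebra over $\mathbb K$ with $\pi_1(x,y)=x\cdot y$, $\pi_2(x,y)=x\ast y$, and let $(V,\rho,\mu,\tilde\rho,\tilde\mu)$ be a representation of $(\mathfrak g,\cdot,\ast)$. Then $(\pi_1+\rho+\mu,\pi_2+\tilde\rho+\tilde\mu)$ is a Maurer-Cartan element of the bidifferential graded Lie algebra $(C^*(\mathfrak g\oplus V;\mathfrak g\oplus V),[\cdot,\cdot]^{MN},\mathrm d_1=0,\mathrm d_2=0)$, i.e. $$[\pi_1+\rho+\mu,\pi_1+\rho+\mu]^{MN}=0,\quad[\pi_2+\tilde\rho+\tilde\mu,\pi_2+\tilde\rho+\tilde\mu]^{MN}=0,\quad[\pi_1+\rho+\mu,\pi_2+\tilde\rho+\tilde\mu]^{MN}=0.$$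
   Context: Pre-Lie algebra: a vector space with a bilinear product $\cdot$ satisfying $(x\cdot y)\cdot z-x\cdot(y\cdot z)=(y\cdot x)\cdot z-y\cdot(x\cdot z)$. Compatible pre-Lie algebra: a triple $(\mathfrak g,\cdot,\ast)$ where $\cdot,\ast$ are pre-Lie products such that $(x\ast y)\cdot z+(x\cdot y)\ast z-x\cdot(y\ast z)-x\ast(y\cdot z)-(y\ast x)\cdot z-(y\cdot x)\ast z+y\cdot(x\ast z)+y\ast(x\cdot z)=0$. Representation of a pre-Lie algebra $(\mathfrak g,\cdot)$ on $V$: linear maps $\rho,\mu:\mathfrak g\to\mathfrak{gl}(V)$ with $\rho(x\cdot y-y\cdot x)=\rho(x)\rho(y)-\rho(y)\rho(x)$ and $\mu(y)\mu(x)-\mu(x\cdot y)=\mu(y)\rho(x)-\rho(x)\mu(y)$. Representation of $(\mathfrak g,\cdot,\ast)$: $(V,\rho,\mu,\tilde\rho,\tilde\mu)$ with $(V,\rho,\mu)$ a representation of $(\mathfrak g,\cdot)$, $(V,\tilde\rho,\tilde\mu)$ a representation of $(\mathfrak g,\ast)$, and for all $x,y$: $\rho(x\ast y)+\tilde\rho(x\cdot y)-\rho(x)\tilde\rho(y)-\tilde\rho(x)\rho(y)=\rho(y\ast x)+\tilde\rho(y\cdot x)-\rho(y)\tilde\rho(x)-\tilde\rho(y)\rho(x)$ and $\mu(y)\tilde\rho(x)-\rho(x)\tilde\mu(y)-\mu(y)\tilde\mu(x)+\mu(x\ast y)=-\tilde\mu(y)\rho(x)+\tilde\rho(x)\mu(y)+\tilde\mu(y)\mu(x)-\tilde\mu(x\cdot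 y)$. The element $\pi_1+\rho+\mu\in\mathrm{Hom}(\otimes^2(\mathfrak g\oplus V),\mathfrak g\oplus V)$ is $(x+u,y+v)\mapsto\pi_1(x,y)+\rho(x)v+\mu(y)u$; similarly $\pi_2+\tilde\rho+\tilde\mu$ is $(x+u,y+v)\mapsto\pi_2(x,y)+\tilde\rho(x)v+\tilde\mu(y)u$. For a vector space $W$: $C^n(W;W)=\mathrm{Hom}(\wedge^{n-1}W\otimes W,W)$, $C^*(W;W)=\oplus_{n\ge1}C^n(W;W)$ with $C^{p+1}$ in degree $p$, and the Matsushima-Nijenhuis bracket $[P,Q]^{MN}=P\circ Q-(-1)^{pq}Q\circ P$ ($P\in C^{p+1}$, $Q\in C^{q+1}$), where $$(P\circ Q)(x_1,\dots,x_{p+q+1})=\sum_{\sigma\in\mathbb S_{(q,1,p-1)}}\mathrm{sgn}(\sigma)P(Q(x_{\sigma(1)},\dots,x_{\sigma(q+1)}),x_{\sigma(q+2)},\dots,x_{\sigma(p+q)},x_{p+q+1})$$ $$+(-1)^{pq}\sum_{\sigma\in\mathbb S_{(p,q)}}\mathrm{sgn}(\sigma)P(x_{\sigma(1)},\dots,x_{\sigma(p)},Q(x_{\sigma(p+1)},\dots,x_{\sigma(p+q)},x_{p+q+1})),$$ $\mathbb S_{(i_1,\dots,i_k)}$ denoting unshuffles (permutations increasing on each consecutive block of lengths $i_1,\dots,i_k$), the first sum being empty if $p=0$. This is known to be a graded Lie algebra. A bidifferential graded Lie algebra $(\mathcal G,[\cdot,\cdot],\mathrm d_1,\mathrm d_2)$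 is a graded Lie algebra $\oplus_{i\ge0}\mathfrak g_i$ with two differentials, each making it a differential graded Lie algebra, with $\mathrm d_1\mathrm d_2+\mathrm d_2\mathrm d_1=0$. A pair $(P_1,P_2)\in\mathfrak g_1\oplus\mathfrak g_1$ is a Maurer-Cartan element if $\mathrm d_1P_1+\frac12[P_1,P_1]=0$, $\mathrm d_2P_2+\frac12[P_2,P_2]=0$, $\mathrm d_1P_2+\mathrm d_2P_1+[P_1,P_2]=0$. *)

theory Defs
  imports
    "HOL-Analysis.Product_Vector"
    "HOL-Combinatorics.Permutations"
    "HOL-Library.Function_Algebras"
begin

section \<open>Compatible pre-Lie algebras and their representations\<close>

definition bilinear_map ::
  "('k::field \<Rightarrow> 'a::ab_group_add \<Rightarrow> 'a) \<Rightarrow> ('k \<Rightarrow> 'b::ab_group_add \<Rightarrow> 'b) \<Rightarrow>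
   ('k \<Rightarrow> 'c::ab_group_add \<Rightarrow> 'c) \<Rightarrow> ('a \<Rightarrow> 'b \<Rightarrow> 'c) \<Rightarrow> bool" where
  "bilinear_map s1 s2 s3 f \<longleftrightarrow>
    (\<forall>x. Vector_Spaces.linear s2 s3 (f x)) \<and> (\<forall>y. Vector_Spaces.linear s1 s3 (\<lambda>x. f x y))"

locale pre_lie_algebra = vector_space scale
  for scale :: "'k::field \<Rightarrow> 'g::ab_group_add \<Rightarrow> 'g" +
  fixes mul :: "'g \<Rightarrow> 'g \<Rightarrow> 'g"
  assumes mul_bilinear: "bilinear_map scale scale scale mul"
    and left_symmetric:
      "mul (mul x y) z - mul x (mul y z) = mul (mul y x) z - mul y (mul x z)"

locale compatible_pre_lie_algebra =
  dot: pre_lie_algebra scale dot + ast: pre_lie_algebra scale ast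
  for scale :: "'k::field \<Rightarrow> 'g::ab_group_add \<Rightarrow> 'g"
    and dot :: "'g \<Rightarrow> 'g \<Rightarrow> 'g" (infixl "\<cdot>" 70)
    and ast :: "'g \<Rightarrow> 'g \<Rightarrow> 'g" (infixl "\<star>" 70) +
  assumes compatible:
    "(x \<star> y) \<cdot> z + (x \<cdot> y) \<star> z - x \<cdot> (y \<star> z) - x \<star> (y \<cdot> z)
     - (y \<star> x) \<cdot> z - (y \<cdot> x) \<star> z + y \<cdot> (x \<star> z) + y \<star> (x \<cdot> z) = 0"

text \<open>A linear map from \<open>g\<close> to \<open>gl(V)\<close> is given in curried form, that is, as a bilinear map
  \<open>g \<times> V \<rightarrow> V\<close>; identities between endomorphisms of \<open>V\<close> are evaluated at a vector \<open>v\<close>.\<close>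

locale pre_lie_representation = pre_lie_algebra scale mul + V: vector_space scaleV
  for scale :: "'k::field \<Rightarrow> 'g::ab_group_add \<Rightarrow> 'g"
    and mul :: "'g \<Rightarrow> 'g \<Rightarrow> 'g"
    and scaleV :: "'k \<Rightarrow> 'v::ab_group_add \<Rightarrow> 'v" +
  fixes \<rho> \<mu> :: "'g \<Rightarrow> 'v \<Rightarrow> 'v"
  assumes rho_linear: "bilinear_map scale scaleV scaleV \<rho>"
    and mu_linear: "bilinear_map scale scaleV scaleV \<mu>"
    and rho_commutator: "\<rho> (mul x y - mul y x) v = \<rho> x (\<rho> y v) - \<rho> y (\<rho> x v)"
    and mu_rho: "\<mu> y (\<mu> x v) - \<mu> (mul x y) v = \<mu> y (\<rho> x v) - \<rho> x (\<mu> y v)"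

locale compatible_pre_lie_representation =
  compatible_pre_lie_algebra scale dot ast +
  dot: pre_lie_representation scale dot scaleV \<rho> \<mu> +
  ast: pre_lie_representation scale ast scaleV \<rho>' \<mu>'
  for scale :: "'k::field \<Rightarrow> 'g::ab_group_add \<Rightarrow> 'g"
    and dot :: "'g \<Rightarrow> 'g \<Rightarrow> 'g" (infixl "\<cdot>" 70)
    and ast :: "'g \<Rightarrow> 'g \<Rightarrow> 'g" (infixl "\<star>" 70)
    and scaleV :: "'k \<Rightarrow> 'v::ab_group_add \<Rightarrow> 'v"
    and \<rho> \<mu> \<rho>' \<mu>' :: "'g \<Rightarrow> 'v \<Rightarrow> 'v" +
  assumes rho_compatible:
    "\<rho> (x \<star> y) v + \<rho>' (x \<cdot> y) v - \<rho> x (\<rho>' y v) - \<rho>' x (\<rho> y v)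
     = \<rho> (y \<star> x) v + \<rho>' (y \<cdot> x) v - \<rho> y (\<rho>' x v) - \<rho>' y (\<rho> x v)"
    and mu_compatible:
    "\<mu> y (\<rho>' x v) - \<rho> x (\<mu>' y v) - \<mu> y (\<mu>' x v) + \<mu> (x \<star> y) v
     = - \<mu>' y (\<rho> x v) + \<rho>' x (\<mu> y v) + \<mu>' y (\<mu> x v) - \<mu>' (x \<cdot> y) v"


section \<open>Bidifferential graded Lie algebras\<close>

text \<open>\<open>G i\<close> is the component of degree \<open>i\<close>. The underlying space is the direct sum of the \<open>G i\<close>,
  realised as a subspace of the ambient type; \<open>bracket\<close>, \<open>d\<^sub>1\<close> and \<open>d\<^sub>2\<close> matter only there.\<close>

locale graded_lie_algebra = vector_space scale
  for scale :: "'k::field \<Rightarrow> 'l::ab_group_add \<Rightarrow> 'l" +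
  fixes G :: "nat \<Rightarrow> 'l set"
    and bracket :: "'l \<Rightarrow> 'l \<Rightarrow> 'l"
  assumes G_subspace: "subspace (G i)"
    and G_direct: "\<lbrakk>finite I; \<And>i. i \<in> I \<Longrightarrow> f i \<in> G i; (\<Sum>i\<in>I. f i) = 0; i \<in> I\<rbrakk> \<Longrightarrow> f i = 0"
    and bracket_add_left:
      "\<lbrakk>x \<in> span (\<Union>i. G i); y \<in> span (\<Union>i. G i); z \<in> span (\<Union>i. G i)\<rbrakk>
       \<Longrightarrow> bracket (x + y) z = bracket x z + bracket y z"
    and bracket_add_right:
      "\<lbrakk>x \<in> span (\<Union>i. G i); y \<in> span (\<Union>i. G i); z \<in> span (\<Union>i. G i)\<rbrakk>
       \<Longrightarrow> bracket x (y + z) = bracket x y + bracket x z"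
    and bracket_scale_left:
      "\<lbrakk>x \<in> span (\<Union>i. G i); y \<in> span (\<Union>i. G i)\<rbrakk>
       \<Longrightarrow> bracket (scale c x) y = scale c (bracket x y)"
    and bracket_scale_right:
      "\<lbrakk>x \<in> span (\<Union>i. G i); y \<in> span (\<Union>i. G i)\<rbrakk>
       \<Longrightarrow> bracket x (scale c y) = scale c (bracket x y)"
    and bracket_degree: "\<lbrakk>x \<in> G i; y \<in> G j\<rbrakk> \<Longrightarrow> bracket x y \<in> G (i + j)"
    and bracket_skew:
      "\<lbrakk>x \<in> G i; y \<in> G j\<rbrakk> \<Longrightarrow> bracket x y = - scale ((- 1) ^ (i * j)) (bracket y x)"
    and bracket_jacobi:
      "\<lbrakk>x \<in> G i; y \<in> G j; z \<in> G k\<rbrakk> \<Longrightarrow>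
       bracket x (bracket y z)
       = bracket (bracket x y) z + scale ((- 1) ^ (i * j)) (bracket y (bracket x z))"

locale differential_graded_lie_algebra = graded_lie_algebra scale G bracket
  for scale :: "'k::field \<Rightarrow> 'l::ab_group_add \<Rightarrow> 'l"
    and G :: "nat \<Rightarrow> 'l set"
    and bracket :: "'l \<Rightarrow> 'l \<Rightarrow> 'l" +
  fixes d :: "'l \<Rightarrow> 'l"
  assumes d_add:
      "\<lbrakk>x \<in> span (\<Union>i. G i); y \<in> span (\<Union>i. G i)\<rbrakk> \<Longrightarrow> d (x + y) = d x + d y"
    and d_scale: "x \<in> span (\<Union>i. G i) \<Longrightarrow> d (scale c x) = scale c (d x)"
    and d_degree: "x \<in> G i \<Longrightarrow> d x \<in> G (Suc i)"
    and d_square: "x \<in> span (\<Union>i. G i) \<Longrightarrow> d (d x) = 0"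
    and d_derivation:
      "\<lbrakk>x \<in> G i; y \<in> G j\<rbrakk> \<Longrightarrow>
       d (bracket x y) = bracket (d x) y + scale ((- 1) ^ i) (bracket x (d y))"

locale bidifferential_graded_lie_algebra =
  d1: differential_graded_lie_algebra scale G bracket d\<^sub>1 +
  d2: differential_graded_lie_algebra scale G bracket d\<^sub>2
  for scale :: "'k::field \<Rightarrow> 'l::ab_group_add \<Rightarrow> 'l"
    and G :: "nat \<Rightarrow> 'l set"
    and bracket :: "'l \<Rightarrow> 'l \<Rightarrow> 'l"
    and d\<^sub>1 d\<^sub>2 :: "'l \<Rightarrow> 'l" +
  assumes d_anticommute: "x \<in> d1.span (\<Union>i. G i) \<Longrightarrow> d\<^sub>1 (d\<^sub>2 x) + d\<^sub>2 (d\<^sub>1 x) = 0"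

lemma (in graded_lie_algebra) bidifferential_zero:
  "bidifferential_graded_lie_algebra scale G bracket (\<lambda>_. 0) (\<lambda>_. 0)"
proof -
  have sp: "x \<in> span (\<Union>i. G i)" if "x \<in> G i" for x i
    using that by (auto intro: span_base)
  have br0: "bracket 0 y = 0" "bracket y 0 = 0" if "y \<in> G j" for y j
    using bracket_scale_left[OF sp[OF that] sp[OF that], of 0]
      bracket_scale_right[OF sp[OF that] sp[OF that], of 0] by simp_all
  have "differential_graded_lie_algebra scale G bracket (\<lambda>_. 0)"
    by (intro differential_graded_lie_algebra.intro graded_lie_algebra_axioms
        differential_graded_lie_algebra_axioms.intro)
      (simp_all add: br0 subspace_0[OF G_subspace])
  then show ?thesis
    by (simp add: bidifferential_graded_lie_algebra_def
        bidifferential_graded_lie_algebra_axioms_def)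
qed

text \<open>The Maurer--Cartan conditions depend only on the structure maps, so they are stated for
  arbitrary data; the axioms of a bidifferential graded Lie algebra are not part of the predicate.\<close>

definition maurer_cartan ::
  "('k::field \<Rightarrow> 'l::ab_group_add \<Rightarrow> 'l) \<Rightarrow> (nat \<Rightarrow> 'l set) \<Rightarrow> ('l \<Rightarrow> 'l \<Rightarrow> 'l) \<Rightarrow>
   ('l \<Rightarrow> 'l) \<Rightarrow> ('l \<Rightarrow> 'l) \<Rightarrow> 'l \<Rightarrow> 'l \<Rightarrow> bool" where
  "maurer_cartan s G bracket d\<^sub>1 d\<^sub>2 P\<^sub>1 P\<^sub>2 \<longleftrightarrow>
     P\<^sub>1 \<in> G 1 \<and> P\<^sub>2 \<in> G 1 \<and>
     d\<^sub>1 P\<^sub>1 + s (1 / 2) (bracket P\<^sub>1 P\<^sub>1) = 0 \<and>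
     d\<^sub>2 P\<^sub>2 + s (1 / 2) (bracket P\<^sub>2 P\<^sub>2) = 0 \<and>
     d\<^sub>1 P\<^sub>2 + d\<^sub>2 P\<^sub>1 + bracket P\<^sub>1 P\<^sub>2 = 0"


section \<open>The Matsushima--Nijenhuis bracket\<close>

text \<open>A cochain is a function on argument lists. An element of \<open>C\<^sup>n(W;W)\<close>, a linear map from
  \<open>\<Lambda>\<^sup>n\<^sup>-\<^sup>1 W \<otimes> W\<close> to \<open>W\<close>, is identified with a multilinear map of \<open>n\<close> arguments alternating in the
  first \<open>n - 1\<close> ones, extended by \<open>0\<close> to lists of any other length. In this way the \<open>C\<^sup>n(W;W)\<close>
  are independent subspaces of \<open>'w list \<Rightarrow> 'w\<close>, whose span is \<open>C\<^sup>*(W;W)\<close>.\<close>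

definition cochains :: "('k::field \<Rightarrow> 'w::ab_group_add \<Rightarrow> 'w) \<Rightarrow> nat \<Rightarrow> ('w list \<Rightarrow> 'w) set" where
  "cochains s n =
    {P. (\<forall>xs. length xs \<noteq> n \<longrightarrow> P xs = 0) \<and>
        (\<forall>xs i. length xs = n \<longrightarrow> i < n \<longrightarrow> Vector_Spaces.linear s s (\<lambda>x. P (xs[i := x]))) \<and>
        (\<forall>xs i j. length xs = n \<longrightarrow> i < j \<longrightarrow> j < n - 1 \<longrightarrow> xs ! i = xs ! j \<longrightarrow> P xs = 0)}"

definition mn_grading :: "('k::field \<Rightarrow> 'w::ab_group_add \<Rightarrow> 'w) \<Rightarrow> nat \<Rightarrow> ('w list \<Rightarrow> 'w) set" where
  "mn_grading s p = cochains s (p + 1)"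

definition cochain_scale ::
  "('k::field \<Rightarrow> 'w::ab_group_add \<Rightarrow> 'w) \<Rightarrow> 'k \<Rightarrow> ('w list \<Rightarrow> 'w) \<Rightarrow> 'w list \<Rightarrow> 'w" where
  "cochain_scale s c P = (\<lambda>xs. s c (P xs))"

text \<open>Positions are counted from \<open>0\<close>: block \<open>m\<close> of \<open>ks\<close> starts at the sum of the first \<open>m\<close> lengths.\<close>

definition unshuffles :: "nat list \<Rightarrow> (nat \<Rightarrow> nat) set" where
  "unshuffles ks =
    {\<sigma>. \<sigma> permutes {..<sum_list ks} \<and>
        (\<forall>m<length ks. strict_mono_on {sum_list (take m ks)..<sum_list (take (Suc m) ks)} \<sigma>)}"

text \<open>\<open>P \<circ> Q\<close> for \<open>P \<in> C\<^sup>p\<^sup>+\<^sup>1\<close> and \<open>Q \<in> C\<^sup>q\<^sup>+\<^sup>1\<close>, evaluated at a list of length \<open>p + q + 1\<close>.\<close>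

definition mn_circ ::
  "('k::field \<Rightarrow> 'w::ab_group_add \<Rightarrow> 'w) \<Rightarrow> nat \<Rightarrow> nat \<Rightarrow>
   ('w list \<Rightarrow> 'w) \<Rightarrow> ('w list \<Rightarrow> 'w) \<Rightarrow> 'w list \<Rightarrow> 'w" where
  "mn_circ s p q P Q xs =
     (if p = 0 then 0 else
       \<Sum>\<sigma>\<in>unshuffles [q, 1, p - 1]. s (of_int (sign \<sigma>))
         (P (Q (map (\<lambda>i. xs ! \<sigma> i) [0..<q + 1]) #
             map (\<lambda>i. xs ! \<sigma> i) [q + 1..<p + q] @ [xs ! (p + q)])))
     + s ((- 1) ^ (p * q))
       (\<Sum>\<sigma>\<in>unshuffles [p, q]. s (of_int (sign \<sigma>))
         (P (map (\<lambda>i. xs ! \<sigma> i) [0..<p] @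
             [Q (map (\<lambda>i. xs ! \<sigma> i) [p..<p + q] @ [xs ! (p + q)])])))"

text \<open>The bilinear extension of the bracket to \<open>C\<^sup>*(W;W)\<close>: on lists of length \<open>n + 1\<close> the homogeneous
  components of degrees \<open>p\<close> and \<open>q\<close> with \<open>p + q = n\<close> contribute.\<close>

definition mn_bracket ::
  "('k::field \<Rightarrow> 'w::ab_group_add \<Rightarrow> 'w) \<Rightarrow>
   ('w list \<Rightarrow> 'w) \<Rightarrow> ('w list \<Rightarrow> 'w) \<Rightarrow> 'w list \<Rightarrow> 'w" where
  "mn_bracket s P Q xs =
     (\<Sum>(p, q)\<in>{(p, q). p + q + 1 = length xs}.
        mn_circ s p q P Q xs - s ((- 1) ^ (p * q)) (mn_circ s q p Q P xs))"

lemma mn_circ_zero: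
  assumes "vector_space s" "P \<in> cochains s (a + 1)" "Q \<in> cochains s (b + 1)"
    and "p + q = a + b" "p \<noteq> a"
  shows "mn_circ s p q P Q xs = 0"
proof -
  interpret vector_space s by fact
  have P: "P ys = 0" if "length ys \<noteq> a + 1" for ys
    using assms(2) that by (auto simp: cochains_def)
  show ?thesis
    using assms(4,5) by (auto simp: mn_circ_def P)
qed

lemma mn_bracket_homogeneous:
  assumes "vector_space s" "P \<in> cochains s (p + 1)" "Q \<in> cochains s (q + 1)"
    and len: "length xs = p + q + 1"
  shows "mn_bracket s P Q xs
    = mn_circ s p q P Q xs - s ((- 1) ^ (p * q)) (mn_circ s q p Q P xs)"
proof -
  interpret vector_space s by fact
  let ?f = "\<lambda>(a, b). mn_circ s a b P Q xs - s ((- 1) ^ (a * b)) (mn_circ s b a Q P xs)"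
  let ?A = "{(a, b). a + b + 1 = length xs}"
  have fin: "finite ?A"
    by (rule finite_subset[of _ "{..length xs} \<times> {..length xs}"]) auto
  have "?f ab = 0" if "ab \<in> ?A - {(p, q)}" for ab
  proof -
    obtain a b where ab: "ab = (a, b)" by force
    have "a + b = p + q" "a \<noteq> p" "b \<noteq> q" using that len ab by auto
    then show ?thesis
      using mn_circ_zero[OF assms(1,2,3), of a b xs] mn_circ_zero[OF assms(1,3,2), of b a xs]
      by (simp add: ab add.commute)
  qed
  then have "sum ?f ?A = sum ?f {(p, q)}"
    using len by (intro sum.mono_neutral_right fin) auto
  then show ?thesis by (simp add: mn_bracket_def)
qed


section \<open>The element \<open>\<pi> + \<rho> + \<mu>\<close>\<close>

definition semidirect_cochain ::
  "('g \<Rightarrow> 'g \<Rightarrow> 'g) \<Rightarrow> ('g \<Rightarrow> 'v \<Rightarrow> 'v) \<Rightarrow> ('g \<Rightarrow> 'v \<Rightarrow> 'v) \<Rightarrow>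
   ('g::ab_group_add \<times> 'v::ab_group_add) list \<Rightarrow> 'g \<times> 'v" where
  "semidirect_cochain \<pi> \<rho> \<mu> zs =
     (case zs of [(x, u), (y, v)] \<Rightarrow> (\<pi> x y, \<rho> x v + \<mu> y u) | _ \<Rightarrow> 0)"

end

theory Submission
  imports Defs
begin

text \<open>For \<open>p = q = 1\<close> the circle product unfolds to
  \<open>(P \<circ> Q)(a, b, c) = P(Q(a, b), c) - P(Q(b, a), c) - P(a, Q(b, c)) + P(b, Q(a, c))\<close>.
  Hence the bracket of two such cochains is the polarised left-symmetry condition, and on
  \<open>g \<oplus> V\<close> it splits into the compatibility of the products and that of the actions.
  The two self-brackets are the special case of a structure that is compatible with itself.\<close>

lemma permutes_lessThan_2_iff: "\<sigma> permutes {..<2::nat} \<longleftrightarrow> \<sigma> = id \<or> \<sigma> = transpose 0 1"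
proof -
  have "{..<2::nat} = {0, 1}" by auto
  then show ?thesis by (simp only: permutes_doubleton_iff)
qed

text \<open>Blocks of length one impose no monotonicity, so both permutations of the two positions
  qualify. The variant below, with an empty last block of length \<open>p - 1\<close>, serves the
  first sum of \<open>mn_circ\<close> at \<open>p = q = 1\<close>.\<close>

lemma unshuffles_1_1: "unshuffles [1, 1] = {id, transpose 0 1}"
  unfolding set_eq_iff insert_iff empty_iff permutes_lessThan_2_iff[symmetric] simp_thms
  by (auto simp: unshuffles_def less_Suc_eq strict_mono_on_def numeral_2_eq_2)

lemma unshuffles_1_1_0: "unshuffles [1, 1, 0] = {id, transpose 0 1}"
  unfolding set_eq_iff insert_iff empty_iff permutes_lessThan_2_iff[symmetric] simp_thms
  by (auto simp: unshuffles_def less_Suc_eq strict_mono_on_def numeral_2_eq_2)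

lemma bilinear_mapD:
  assumes "bilinear_map s1 s2 s3 f"
  shows "f (x + x') y = f x y + f x' y" "f x (y + y') = f x y + f x y'"
    and "f (s1 c x) y = s3 c (f x y)" "f x (s2 c y) = s3 c (f x y)"
    and "f (x - x') y = f x y - f x' y" "f x (y - y') = f x y - f x y'"
proof -
  have hom: "module_hom s2 s3 (f x)" "module_hom s1 s3 (\<lambda>x. f x y)" for x y
    using assms by (auto simp: bilinear_map_def module_hom_eq_linear)
  show "f (x + x') y = f x y + f x' y" "f x (y + y') = f x y + f x y'"
    "f (s1 c x) y = s3 c (f x y)" "f x (s2 c y) = s3 c (f x y)"
    "f (x - x') y = f x y - f x' y" "f x (y - y') = f x y - f x y'"
    using module_hom.add[OF hom(1)] module_hom.add[OF hom(2)]
      module_hom.scale[OF hom(1)] module_hom.scale[OF hom(2)]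
      module_hom.diff[OF hom(1)] module_hom.diff[OF hom(2)]
    by auto
qed

context vector_space
begin

lemma mn_circ_1_1:
  "mn_circ scale 1 1 P Q [a, b, c]
   = P [Q [a, b], c] - P [Q [b, a], c] - (P [a, Q [b, c]] - P [b, Q [a, c]])"
proof -
  \<comment> \<open>Distinctness keeps the sum over \<open>{id, transpose 0 1}\<close> from
    collapsing to one term.\<close>
  have ne: "id \<noteq> transpose 0 (1::nat)"
    by (auto simp: fun_eq_iff transpose_def)
  show ?thesis
    unfolding mn_circ_def
    by (simp add: unshuffles_1_1[simplified] unshuffles_1_1_0[simplified] ne[simplified]
        sign_swap_id)
qed

text \<open>Alternation concerns only the first \<open>n - 1\<close> arguments, hence is vacuous for
  \<open>n = 2\<close>.\<close>

lemma cochains_2I: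
  assumes "bilinear_map scale scale scale (\<lambda>x y. P [x, y])"
    and "\<And>xs. length xs \<noteq> 2 \<Longrightarrow> P xs = 0"
  shows "P \<in> cochains scale 2"
  using assms
  by (auto simp: cochains_def bilinear_map_def length_Suc_conv numeral_2_eq_2 less_Suc_eq)

lemma cochains_2_zero:
  assumes "P \<in> cochains scale 2"
  shows "P [0, x] = 0" "P [x, 0] = 0"
proof -
  have hom: "module_hom scale scale (\<lambda>y. P ([x, x][i := y]))" if "i < 2" for i
  proof -
    have "length [x, x] = 2" by simp
    then show ?thesis
      unfolding module_hom_eq_linear using assms that unfolding cochains_def by blast
  qed
  show "P [0, x] = 0" "P [x, 0] = 0"
    using module_hom.zero[OF hom[of 0]] module_hom.zero[OF hom[of 1]] by simp_all
qed

text \<open>In degree one the sign \<open>-(-1)^(1 * 1)\<close> is \<open>+1\<close>, so the bracket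
  is the symmetric sum of the two circle products on lists of length 3. Lists of other lengths are
  handled by counting arguments.\<close>

lemma mn_bracket_eq_0I:
  assumes "P \<in> cochains scale 2" "Q \<in> cochains scale 2"
    and "\<And>a b c. mn_circ scale 1 1 P Q [a, b, c] + mn_circ scale 1 1 Q P [a, b, c] = 0"
  shows "mn_bracket scale P Q = 0"
proof
  \<comment> \<open>If \<open>p\<close> is not 1, the outer cochain receives \<open>p + 1\<close>
    arguments, the wrong number. If \<open>p = 1\<close>, then \<open>q\<close> is not 1, so the
    inner cochain returns 0 and the outer one has a zero argument.\<close>
  have zero: "mn_circ scale p q P Q xs = 0"
    if "P \<in> cochains scale 2" "Q \<in> cochains scale 2" "p + q \<noteq> 2" for p q P Q xs
  proof -
    have len: "P ys = 0" "Q ys = 0" if "length ys \<noteq> 2" for ys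
      using \<open>P \<in> _\<close> \<open>Q \<in> _\<close> that by (auto simp: cochains_def)
    show ?thesis
      using that(3) cochains_2_zero[OF that(1)] by (cases "p = 1") (auto simp: mn_circ_def len)
  qed
  fix xs :: "'b list"
  show "mn_bracket scale P Q xs = 0 xs"
  proof (cases "length xs = 3")
    case True
    then obtain a b c where "xs = [a, b, c]"
      by (auto simp: numeral_3_eq_3 length_Suc_conv)
    then show ?thesis
      using mn_bracket_homogeneous[OF vector_space_axioms, of P 1 Q 1 xs] assms
      by (simp add: numeral_2_eq_2)
  next
    case False
    then show ?thesis
      unfolding mn_bracket_def using assms
      by (auto intro!: sum.neutral simp: zero)
  qed
qed

end

text \<open>For equal structures the mixed conditions on the product and on \<open>\<rho>\<close>
  are the ordinary ones doubled. Each axiom is solved for one term, which is then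
  substituted.\<close>

lemma (in pre_lie_representation) compatible_self:
  "compatible_pre_lie_representation scale mul mul scaleV \<rho> \<mu> \<rho> \<mu>"
proof unfold_locales
  fix x y z v
  have "mul (mul x y) z = mul (mul y x) z - mul y (mul x z) + mul x (mul y z)"
    by (simp only: left_symmetric[of x y z, symmetric] diff_add_cancel)
  then show "mul (mul x y) z + mul (mul x y) z - mul x (mul y z) - mul x (mul y z)
      - mul (mul y x) z - mul (mul y x) z + mul y (mul x z) + mul y (mul x z) = 0"
    by simp
  have "\<rho> (mul x y) v = \<rho> x (\<rho> y v) - \<rho> y (\<rho> x v) + \<rho> (mul y x) v"
    by (simp only: rho_commutator[symmetric] bilinear_mapD(5)[OF rho_linear] diff_add_cancel)
  then show "\<rho> (mul x y) v + \<rho> (mul x y) v - \<rho> x (\<rho> y v) - \<rho> x (\<rho> y v)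
      = \<rho> (mul y x) v + \<rho> (mul y x) v - \<rho> y (\<rho> x v) - \<rho> y (\<rho> x v)"
    by simp
  \<comment> \<open>In the condition on \<open>\<mu>\<close> the two sides are negatives of each
    other; the substitution makes both vanish.\<close>
  have "\<mu> (mul x y) v = \<mu> y (\<mu> x v) - (\<mu> y (\<rho> x v) - \<rho> x (\<mu> y v))"
    by (simp only: mu_rho[symmetric]) simp
  then show "\<mu> y (\<rho> x v) - \<rho> x (\<mu> y v) - \<mu> y (\<mu> x v) + \<mu> (mul x y) v
      = - \<mu> y (\<rho> x v) + \<rho> x (\<mu> y v) + \<mu> y (\<mu> x v) - \<mu> (mul x y) v"
    by simp
qed

context pre_lie_representation
begin

text \<open>Makes the cochain lemmas above available on the direct sum of g and V, under the prefix
  \<open>prod.p\<close>.\<close>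

sublocale prod: vector_space_prod scale scaleV
  by unfold_locales

lemma semidirect_cochain_in_cochains:
  "semidirect_cochain mul \<rho> \<mu> \<in> cochains prod.scale 2"
proof (rule prod.p.cochains_2I)
  have "module_hom prod.scale prod.scale (\<lambda>y. semidirect_cochain mul \<rho> \<mu> [x, y])"
    "module_hom prod.scale prod.scale (\<lambda>x. semidirect_cochain mul \<rho> \<mu> [x, y])" for x y
    by (unfold_locales;
        auto simp: semidirect_cochain_def prod.scale_def split_beta V.scale_right_distrib
          bilinear_mapD[OF mul_bilinear] bilinear_mapD[OF rho_linear] bilinear_mapD[OF mu_linear])+
  then show "bilinear_map prod.scale prod.scale prod.scale
      (\<lambda>x y. semidirect_cochain mul \<rho> \<mu> [x, y])"
    by (simp add: bilinear_map_def module_hom_eq_linear)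
  show "semidirect_cochain mul \<rho> \<mu> xs = 0" if "length xs \<noteq> 2" for xs
    using that by (auto simp: semidirect_cochain_def split: list.split)
qed

end

lemma (in compatible_pre_lie_representation) mn_bracket_semidirect_cochain:
  "mn_bracket (module_prod.scale scale scaleV)
     (semidirect_cochain dot \<rho> \<mu>) (semidirect_cochain ast \<rho>' \<mu>') = 0"
proof (rule dot.prod.p.mn_bracket_eq_0I)
  fix a b c :: "'g \<times> 'v"
  obtain x u y v z w where abc: "a = (x, u)" "b = (y, v)" "c = (z, w)"
    by (cases a, cases b, cases c) auto
  note bl = bilinear_mapD[OF dot.mul_bilinear] bilinear_mapD[OF ast.mul_bilinear]
    bilinear_mapD[OF dot.rho_linear] bilinear_mapD[OF ast.rho_linear]
    bilinear_mapD[OF dot.mu_linear] bilinear_mapD[OF ast.mu_linear]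
  let ?mc = "mn_circ (module_prod.scale scale scaleV) 1 1"
  \<comment> \<open>The defect is trilinear and skew in its first two arguments. \<open>?C\<close>
    is its g-component; in V, the vector \<open>w\<close> in the third slot yields the difference of
    \<open>?R\<close>, \<open>v\<close> in the second yields \<open>?L - ?M\<close>, and
    \<open>u\<close> in the first yields the same with a minus sign.\<close>
  let ?C = "(x \<star> y) \<cdot> z + (x \<cdot> y) \<star> z - x \<cdot> (y \<star> z) - x \<star> (y \<cdot> z)
     - (y \<star> x) \<cdot> z - (y \<cdot> x) \<star> z + y \<cdot> (x \<star> z) + y \<star> (x \<cdot> z)"
  let ?R = "\<lambda>x y. \<rho> (x \<star> y) w + \<rho>' (x \<cdot> y) w - \<rho> x (\<rho>' y w) - \<rho>' x (\<rho> y w)"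
  let ?L = "\<lambda>x v. \<mu> z (\<rho>' x v) - \<rho> x (\<mu>' z v) - \<mu> z (\<mu>' x v) + \<mu> (x \<star> z) v"
  let ?M = "\<lambda>x v. - \<mu>' z (\<rho> x v) + \<rho>' x (\<mu> z v) + \<mu>' z (\<mu> x v) - \<mu>' (x \<cdot> z) v"
  have "?mc (semidirect_cochain dot \<rho> \<mu>) (semidirect_cochain ast \<rho>' \<mu>') [a, b, c]
      + ?mc (semidirect_cochain ast \<rho>' \<mu>') (semidirect_cochain dot \<rho> \<mu>) [a, b, c]
      = (?C, (?R x y - ?R y x) + (?L x v - ?M x v) - (?L y u - ?M y u))"
    unfolding dot.prod.p.mn_circ_1_1 abc
    by (simp add: semidirect_cochain_def bl)
  also have "\<dots> = 0"
    \<comment> \<open>\<open>rho_compatible\<close> merely exchanges \<open>x\<close> and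
      \<open>y\<close>, so a fixed instance gives the rewriting a direction.\<close>
    by (simp only: compatible rho_compatible[of x y w] mu_compatible) (simp add: zero_prod_def)
  finally show "?mc (semidirect_cochain dot \<rho> \<mu>) (semidirect_cochain ast \<rho>' \<mu>') [a, b, c]
      + ?mc (semidirect_cochain ast \<rho>' \<mu>') (semidirect_cochain dot \<rho> \<mu>) [a, b, c] = 0" .
qed (fact dot.semidirect_cochain_in_cochains ast.semidirect_cochain_in_cochains)+

theorem proposition4p4:
  fixes scale_g :: "'k::field \<Rightarrow> 'g::ab_group_add \<Rightarrow> 'g"
    and scale_V :: "'k \<Rightarrow> 'v::ab_group_add \<Rightarrow> 'v"
    and \<pi>\<^sub>1 \<pi>\<^sub>2 :: "'g \<Rightarrow> 'g \<Rightarrow> 'g"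
    and \<rho> \<mu> \<rho>' \<mu>' :: "'g \<Rightarrow> 'v \<Rightarrow> 'v"
  defines "s \<equiv> module_prod.scale scale_g scale_V"
    and "P\<^sub>1 \<equiv> semidirect_cochain \<pi>\<^sub>1 \<rho> \<mu>"
    and "P\<^sub>2 \<equiv> semidirect_cochain \<pi>\<^sub>2 \<rho>' \<mu>'"
  assumes char: "CHAR('k) \<noteq> 2"
    and g: "compatible_pre_lie_algebra scale_g \<pi>\<^sub>1 \<pi>\<^sub>2"
    and V: "compatible_pre_lie_representation scale_g \<pi>\<^sub>1 \<pi>\<^sub>2 scale_V \<rho> \<mu> \<rho>' \<mu>'"
  shows "maurer_cartan
           (cochain_scale s) (mn_grading s) (mn_bracket s) (\<lambda>_. 0) (\<lambda>_. 0) P\<^sub>1 P\<^sub>2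
         \<and> mn_bracket s P\<^sub>1 P\<^sub>1 = 0 \<and> mn_bracket s P\<^sub>2 P\<^sub>2 = 0 \<and> mn_bracket s P\<^sub>1 P\<^sub>2 = 0"
proof -
  interpret compatible_pre_lie_representation scale_g \<pi>\<^sub>1 \<pi>\<^sub>2 scale_V \<rho> \<mu> \<rho>' \<mu>' by (fact V)
  note self = compatible_pre_lie_representation.mn_bracket_semidirect_cochain
  have "mn_bracket s P\<^sub>1 P\<^sub>1 = 0" "mn_bracket s P\<^sub>2 P\<^sub>2 = 0" "mn_bracket s P\<^sub>1 P\<^sub>2 = 0"
    unfolding s_def P\<^sub>1_def P\<^sub>2_def
    by (fact self[OF dot.compatible_self] self[OF ast.compatible_self]
        mn_bracket_semidirect_cochain)+
  moreover have "P\<^sub>1 \<in> mn_grading s 1" "P\<^sub>2 \<in> mn_grading s 1"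
    using dot.semidirect_cochain_in_cochains ast.semidirect_cochain_in_cochains
    by (simp_all add: s_def P\<^sub>1_def P\<^sub>2_def mn_grading_def numeral_2_eq_2)
  \<comment> \<open>Needed for the factor 1/2 in front of the vanishing self-brackets.\<close>
  moreover have "cochain_scale s c 0 = 0" for c
    by (simp add: cochain_scale_def s_def fun_eq_iff)
  ultimately show ?thesis
    by (simp add: maurer_cartan_def)
qed

end
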